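(* Let $\mu$ be the normalized Haar measure on the group $\mathsf{U}(d)$ of $d\times d$ unitary matrices, and let $A\in M_{d^3}(\mathbb{C})$, regarded as an operator on $(\mathbb{C}^d)^{\otimes3}$. Write $S_3=\{\pi_1=(1),\pi_2=(12),\pi_3=(13),\pi_4=(23),\pi_5=(123),\pi_6=(132)\}$ and $a_j=\operatorname{Tr}(A\,\mathbf{P}(\pi_j^{-1}))$. Then $$\int_{\mathsf{U}(d)}U^{\otimes 3}A(U^{\otimes 3})^\dagger\, d\mu(U) = \sum_{\pi\in S_3}c_\pi(A)\,\mathbf{P}(\pi)=\sum_{j=1}^6 c_j(A)\,\mathbf{P}(\pi_j),$$ where $c_j(A)=c_{\pi_j}(A)$ and $$\begin{aligned} c_1(A) &= a_1\mathrm{Wg}_{d,3}(K_1)+(a_2+a_3+a_4)\mathrm{Wg}_{d,3}(K_2)+(a_5+a_6)\mathrm{Wg}_{d,3}(K_3),\\ c_2(A) &= a_2\mathrm{Wg}_{d,3}(K_1)+(a_1+a_5+a_6)\mathrm{Wg}_{d,3}(K_2)+(a_3+a_4)\mathrm{Wg}_{d,3}(K_3),\\ c_3(A) &= a_3\mathrm{Wg}_{d,3}(K_1)+(a_1+a_5+a_6)\mathrm{Wg}_{d,3}(K_2)+(a_2+a_4)\mathrm{Wg}_{d,3}(K_3),\\ c_4(A) &= a_4\mathrm{Wg}_{d,3}(K_1)+(a_1+a_5+a_6)\mathrm{Wg}_{d,3}(K_2)+(a_2+a_3)\mathrm{Wg}_{d,3}(K_3),\\ c_5(A) &= a_5\mathrm{Wg}_{d,3}(K_1)+(a_2+a_3+a_4)\mathrm{Wg}_{d,3}(K_2)+(a_1+a_6)\mathrm{Wg}_{d,3}(K_3),\\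 c_6(A) &= a_6\mathrm{Wg}_{d,3}(K_1)+(a_2+a_3+a_4)\mathrm{Wg}_{d,3}(K_2)+(a_1+a_5)\mathrm{Wg}_{d,3}(K_3). \end{aligned}$$ Here $$\mathrm{Wg}_{d,3}(K_1)=\frac{d^2-2}{(d-2)(d-1)d(d+1)(d+2)},\quad \mathrm{Wg}_{d,3}(K_2)=-\frac1{(d-2)(d-1)(d+1)(d+2)},\quad \mathrm{Wg}_{d,3}(K_3)=\frac2{(d-2)(d-1)d(d+1)(d+2)}.$$
   Context: For $\pi\in S_3$, $\mathbf{P}(\pi)$ is the operator on $(\mathbb{C}^d)^{\otimes 3}$ given on the standard basis by $\mathbf{P}(\pi)|i_1i_2i_3\rangle=|i_{\pi^{-1}(1)}i_{\pi^{-1}(2)}i_{\pi^{-1}(3)}\rangle$. $K_1=\{(1)\}$, $K_2=\{(12),(13),(23)\}$ and $K_3=\{(123),(132)\}$ are the conjugacy classes of $S_3$, and $\mathrm{Wg}_{d,3}(K_j)$ denotes the value on $K_j$ of the Weingarten function, the class function on $S_3$ whose values are those displayed in the claim. $^\dagger$ is the conjugate transpose. Integrals of operator-valued functions are taken entrywise. *)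

theory Defs
  imports "HOL-Probability.Probability" "HOL-Combinatorics.Combinatorics"
begin

definition conj_transpose :: "complex^'n^'m \<Rightarrow> complex^'m^'n" where
  "conj_transpose A = (\<chi> i j. cnj (A $ j $ i))"

definition cscale :: "complex \<Rightarrow> complex^'n^'m \<Rightarrow> complex^'n^'m" (infixr "*\<^sub>M" 75) where
  "c *\<^sub>M A = (\<chi> i j. c * A $ i $ j)"

definition unitary_group :: "(complex^'d^'d) set" where
  "unitary_group = {U. U ** conj_transpose U = mat 1 \<and> conj_transpose U ** U = mat 1}"

text \<open>
  The normalized Haar measure on the unitary group: a left-invariant Borel probability measure.
  As the group is compact, there is exactly one, and it is also right-invariant. The set
  \<open>(**) V ` B\<close> is the left translate \<open>V B\<close>.
\<close>
definition normalized_haar_unitary :: "(complex^'d^'d) measure \<Rightarrow> bool" where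
  "normalized_haar_unitary \<mu> \<longleftrightarrow>
     prob_space \<mu> \<and>
     space \<mu> = unitary_group \<and>
     sets \<mu> = sets (restrict_space borel unitary_group) \<and>
     (\<forall>V\<in>unitary_group. \<forall>B\<in>sets \<mu>. emeasure \<mu> ((**) V ` B) = emeasure \<mu> B)"

definition entrywise_integral ::
    "'a measure \<Rightarrow> ('a \<Rightarrow> complex^'n^'m) \<Rightarrow> complex^'n^'m" where
  "entrywise_integral \<mu> F = (\<chi> i j. \<integral>x. F x $ i $ j \<partial>\<mu>)"

text \<open>
  The standard basis of the threefold tensor power of \<open>d\<close>-dimensional complex space is indexed by
  functions \<open>i :: 3 \<Rightarrow> 'd\<close>, with \<open>|i\<^sub>1 i\<^sub>2 i\<^sub>3\<rangle>\<close> for \<open>i\<close> such that \<open>i 1 = i\<^sub>1\<close>, \<open>i 2 = i\<^sub>2\<close>, \<open>i 3 = i\<^sub>3\<close>. Operators on it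
  are matrices with this index type, which has \<open>d ^ 3\<close> elements. The type \<open>3\<close> consists of the
  integers modulo 3, and its three elements are \<open>1\<close>, \<open>2\<close> and \<open>3 = 0\<close>.
\<close>
type_synonym 'd op3 = "complex^(3 \<Rightarrow> 'd)^(3 \<Rightarrow> 'd)"

definition tensor_cube :: "complex^('d::finite)^'d \<Rightarrow> 'd op3" where
  "tensor_cube U = (\<chi> i j. \<Prod>k\<in>UNIV. U $ (i k) $ (j k))"

definition S3 :: "(3 \<Rightarrow> 3) set" where
  "S3 = {\<pi>. \<pi> permutes UNIV}"

text \<open>Column \<open>i\<close> of the matrix is the image of the basis vector with index \<open>i\<close>.\<close>
definition perm_op :: "(3 \<Rightarrow> 3) \<Rightarrow> ('d::finite) op3" where
  "perm_op \<pi> = (\<chi> k i. if k = i \<circ> inv \<pi> then 1 else 0)"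

lemma perm_op_basis: "perm_op \<pi> *v axis i 1 = axis (i \<circ> inv \<pi>) 1"
proof (subst vec_eq_iff, intro allI)
  fix k
  have "(perm_op \<pi> *v axis i 1) $ k = (\<Sum>j\<in>UNIV. if j = i then perm_op \<pi> $ k $ j else 0)"
    unfolding matrix_vector_mult_def axis_def vec_lambda_beta by (intro sum.cong) auto
  then show "(perm_op \<pi> *v axis i 1) $ k = axis (i \<circ> inv \<pi>) 1 $ k"
    by (simp add: perm_op_def axis_def)
qed

text \<open>
  \<open>cycle_of_list [x, y, z]\<close> sends \<open>x\<close> to \<open>y\<close>, \<open>y\<close> to \<open>z\<close> and \<open>z\<close> to \<open>x\<close>. Only the indices 1 to 6 are used.
\<close>
definition s3 :: "nat \<Rightarrow> 3 \<Rightarrow> 3" where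
  "s3 j = [id, cycle_of_list [1, 2], cycle_of_list [1, 3], cycle_of_list [2, 3],
           cycle_of_list [1, 2, 3], cycle_of_list [1, 3, 2]] ! (j - 1)"

text \<open>The conjugacy classes; only the indices 1 to 3 are used.\<close>
definition conj_class :: "nat \<Rightarrow> (3 \<Rightarrow> 3) set" where
  "conj_class j = [{id},
                   {cycle_of_list [1, 2], cycle_of_list [1, 3], cycle_of_list [2, 3]},
                   {cycle_of_list [1, 2, 3], cycle_of_list [1, 3, 2]}] ! (j - 1)"

definition weingarten3 :: "nat \<Rightarrow> (3 \<Rightarrow> 3) \<Rightarrow> complex" where
  "weingarten3 n \<pi> = (let d = of_nat n in
     if \<pi> \<in> conj_class 1 then (d\<^sup>2 - 2) / ((d - 2) * (d - 1) * d * (d + 1) * (d + 2))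
     else if \<pi> \<in> conj_class 2 then - 1 / ((d - 2) * (d - 1) * (d + 1) * (d + 2))
     else if \<pi> \<in> conj_class 3 then 2 / ((d - 2) * (d - 1) * d * (d + 1) * (d + 2))
     else 0)"

text \<open>The common value of the Weingarten function on a set of permutations on which it is constant.\<close>
definition Wg3 :: "nat \<Rightarrow> (3 \<Rightarrow> 3) set \<Rightarrow> complex" where
  "Wg3 n K = the_elem (weingarten3 n ` K)"

end

theory Submission
  imports Defs
begin

text \<open>
  By left invariance the averaged operator commutes with every \<open>V \<otimes> V \<otimes> V\<close>, \<open>V\<close> unitary. For
  \<open>d \<ge> 3\<close> such an operator is a combination of the \<open>P(\<pi>)\<close>, and three kinds of unitaries suffice to
  see this. Diagonal phases and permutation matrices determine it on the basis vectors with distinct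
  indices, up to one coefficient per \<open>\<pi>\<close>; after subtracting that combination, rotations
  \<open>e\<^sub>a \<mapsto> (e\<^sub>a + e\<^sub>b) / \<surd>2\<close>, \<open>e\<^sub>b \<mapsto> (e\<^sub>a - e\<^sub>b) / \<surd>2\<close> kill the remaining basis vectors.
  Averaging preserves the traces against the \<open>P(\<pi>)\<close>, so the coefficients solve a linear system with
  the Gram matrix \<open>Tr (P(\<pi>) P(\<sigma>\<^sup>-\<^sup>1)) = d ^ cycles(\<pi>\<sigma>\<^sup>-\<^sup>1)\<close>, whose inverse is given by the Weingarten
  function.
\<close>

section \<open>Tensor cubes and permutation operators\<close>

lemma conj_transpose_nth [simp]: "conj_transpose A $ i $ j = cnj (A $ j $ i)"
  by (simp add: conj_transpose_def)

lemma cscale_nth [simp]: "(c *\<^sub>M A) $ i $ j = c * A $ i $ j"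
  by (simp add: cscale_def)

lemma matrix_mult_nth: "(A ** B) $ i $ j = (\<Sum>k\<in>UNIV. A $ i $ k * B $ k $ j)"
  by (simp add: matrix_matrix_mult_def)

lemma mat_nth: "mat c $ i $ j = (if i = j then c else 0)"
  by (simp add: mat_def)

lemma conj_transpose_mult: "conj_transpose (A ** B) = conj_transpose B ** conj_transpose A"
  by (simp add: vec_eq_iff matrix_mult_nth mult.commute)

lemma conj_transpose_conj_transpose [simp]: "conj_transpose (conj_transpose A) = A"
  by (simp add: vec_eq_iff)

lemma unitary_groupI: "U ** conj_transpose U = mat 1 \<Longrightarrow> U \<in> unitary_group"
  by (simp add: unitary_group_def matrix_left_right_inverse)

lemma unitary_group_mult:
  assumes "U \<in> unitary_group" "V \<in> unitary_group"
  shows "U ** V \<in> unitary_group"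
proof (rule unitary_groupI)
  have "(U ** V) ** conj_transpose (U ** V) = U ** (V ** conj_transpose V) ** conj_transpose U"
    by (simp add: conj_transpose_mult matrix_mul_assoc)
  then show "(U ** V) ** conj_transpose (U ** V) = mat 1"
    using assms by (simp add: unitary_group_def)
qed

lemma unitary_group_conj_transpose: "U \<in> unitary_group \<Longrightarrow> conj_transpose U \<in> unitary_group"
  by (auto simp: unitary_group_def)

lemma tensor_cube_nth: "tensor_cube U $ i $ j = (\<Prod>k\<in>UNIV. U $ i k $ j k)"
  by (simp add: tensor_cube_def)

text \<open>Expanding the product of three row-by-column sums gives one term per choice function
  \<open>f :: 3 \<Rightarrow> 'd\<close>, and these functions are exactly the basis indices summed
  over in the matrix product.\<close>

lemma tensor_cube_mult: "tensor_cube (U ** V) = tensor_cube U ** tensor_cube V"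
proof -
  have "(\<Prod>k\<in>UNIV. \<Sum>l\<in>UNIV. U $ i k $ l * V $ l $ j k)
      = (\<Sum>f\<in>UNIV. \<Prod>k\<in>UNIV. U $ i k $ f k * V $ f k $ j k)" for i j :: "3 \<Rightarrow> 'a"
    by (subst prod_sum_PiE) (auto simp: PiE_UNIV_domain)
  then show ?thesis
    by (simp add: vec_eq_iff tensor_cube_nth matrix_mult_nth prod.distrib)
qed

lemma tensor_cube_conj_transpose: "tensor_cube (conj_transpose U) = conj_transpose (tensor_cube U)"
  by (simp add: vec_eq_iff tensor_cube_nth)

lemma tensor_cube_mat: "tensor_cube (mat 1) = mat 1"
  by (auto simp: vec_eq_iff tensor_cube_nth mat_nth fun_eq_iff)

lemma tensor_cube_unitary:
  assumes "U \<in> unitary_group"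
  shows "tensor_cube U ** conj_transpose (tensor_cube U) = mat 1"
    and "conj_transpose (tensor_cube U) ** tensor_cube U = mat 1"
  using assms
  by (simp_all flip: tensor_cube_mult tensor_cube_conj_transpose
      add: unitary_group_def tensor_cube_mat)

lemma mult_perm_op_nth: "(X ** perm_op \<pi>) $ k $ i = X $ k $ (i \<circ> inv \<pi>)"
  by (simp add: matrix_mult_nth perm_op_def if_distrib[of "\<lambda>x. _ * x"] cong: if_cong)

lemma perm_op_mult_nth:
  assumes "bij \<pi>"
  shows "(perm_op \<pi> ** X) $ k $ i = X $ (k \<circ> \<pi>) $ i"
proof -
  have *: "k = j \<circ> inv \<pi> \<longleftrightarrow> j = k \<circ> \<pi>" for j
    using assms by (auto simp: comp_assoc bij_is_inj bij_is_surj surj_iff[THEN iffD1])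
  show ?thesis
    by (simp add: matrix_mult_nth perm_op_def * if_distrib[of "\<lambda>x. x * _"] cong: if_cong)
qed

lemma perm_op_mult: "bij \<pi> \<Longrightarrow> bij \<rho> \<Longrightarrow> perm_op (\<pi> \<circ> \<rho>) = perm_op \<pi> ** perm_op \<rho>"
  by (simp add: vec_eq_iff mult_perm_op_nth, simp add: perm_op_def o_inv_distrib comp_assoc)

text \<open>All three tensor factors carry the same \<open>U\<close>, so permuting the positions
  only reorders a commutative product.\<close>

lemma tensor_cube_perm_op_commute:
  assumes "bij \<pi>"
  shows "tensor_cube U ** perm_op \<pi> = perm_op \<pi> ** tensor_cube U"
proof -
  have "(\<Prod>x\<in>UNIV. U $ k x $ i (inv \<pi> x)) = (\<Prod>x\<in>UNIV. U $ k (\<pi> x) $ i x)" for k i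
    by (rule prod.reindex_bij_betw[of \<pi>, symmetric, THEN trans])
      (use assms in \<open>auto simp: bij_is_inj\<close>)
  then show ?thesis
    by (simp add: vec_eq_iff mult_perm_op_nth perm_op_mult_nth[OF assms] tensor_cube_nth)
qed

section \<open>The commutant\<close>

definition commutes_with_cubes :: "'d::finite op3 \<Rightarrow> bool" where
  "commutes_with_cubes M \<longleftrightarrow> (\<forall>V\<in>unitary_group. tensor_cube V ** M = M ** tensor_cube V)"

lemma commutes_with_cubesD:
  "commutes_with_cubes M \<Longrightarrow> V \<in> unitary_group \<Longrightarrow>
    (tensor_cube V ** M) $ k $ i = (M ** tensor_cube V) $ k $ i"
  unfolding commutes_with_cubes_def by metis

section \<open>Diagonal phases and preservation of weights\<close>

definition phase_matrix :: "'d \<Rightarrow> complex^'d::finite^'d" where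
  "phase_matrix a = (\<chi> i j. if i = j then if i = a then \<i> else 1 else 0)"

lemma phase_matrix_unitary: "phase_matrix a \<in> unitary_group"
  by (rule unitary_groupI)
    (auto simp: vec_eq_iff matrix_mult_nth mat_nth phase_matrix_def
      if_distrib[of cnj] if_distrib[of "\<lambda>x. _ * x"] if_distrib[of "\<lambda>x. x * _"] cong: if_cong)

lemma tensor_cube_phase_matrix:
  "tensor_cube (phase_matrix a) $ k $ i = (if k = i then \<i> ^ card {x. i x = a} else 0)"
proof (cases "k = i")
  case True
  then show ?thesis
    by (simp add: tensor_cube_nth phase_matrix_def prod.If_cases)
next
  case False
  then obtain x where "k x \<noteq> i x" by auto
  then have "\<exists>x\<in>UNIV. phase_matrix a $ k x $ i x = 0" by (auto simp: phase_matrix_def)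
  with False show ?thesis by (simp add: tensor_cube_nth)
qed

lemma commutes_weight:
  assumes "commutes_with_cubes M"
  shows "M $ k $ i * \<i> ^ card {x. i x = a} = \<i> ^ card {x. k x = a} * M $ k $ i"
proof -
  have "(tensor_cube (phase_matrix a) ** M) $ k $ i = (M ** tensor_cube (phase_matrix a)) $ k $ i"
    by (rule commutes_with_cubesD[OF assms phase_matrix_unitary])
  then show ?thesis
    by (auto simp add: matrix_mult_nth tensor_cube_phase_matrix
      if_distrib[of "\<lambda>x. _ * x"] if_distrib[of "\<lambda>x. x * _"] cong: if_cong)
qed

text \<open>A nonzero entry cancels from \<open>commutes_weight\<close>. The phase
  \<open>\<i>\<close> is chosen because its powers with exponents 0 to 3, the possible
  multiplicities of \<open>a\<close> in a triple, are distinct.\<close>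

lemma commutes_count:
  assumes "commutes_with_cubes M" "M $ k $ i \<noteq> 0"
  shows "card {x. k x = a} = card {x. i x = a}"
proof -
  have eq: "\<i> ^ card {x. i x = a} = \<i> ^ card {x. k x = a}"
    using commutes_weight[OF assms(1), of k i a] assms(2) by simp
  have le: "card {x. j x = a} \<in> {0, 1, 2, 3}" for j :: "3 \<Rightarrow> 'a"
  proof -
    have "card {x. j x = a} \<le> 3" using card_mono[of UNIV "{x. j x = a}"] by simp
    then show ?thesis by force
  qed
  show ?thesis
    using eq le[of i] le[of k] by (auto simp: power3_eq_cube complex_eq_iff simp del: card_0_eq)
qed

section \<open>Relabelling the basis\<close>

definition relabel_matrix :: "('d \<Rightarrow> 'd) \<Rightarrow> complex^'d::finite^'d" where
  "relabel_matrix \<tau> = (\<chi> i j. if i = \<tau> j then 1 else 0)"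

lemma relabel_matrix_unitary:
  assumes "bij \<tau>" shows "relabel_matrix \<tau> \<in> unitary_group"
proof (rule unitary_groupI)
  have "\<tau> x = i \<longleftrightarrow> x = inv \<tau> i" "i = \<tau> x \<longleftrightarrow> x = inv \<tau> i" for x i
    using assms by (metis bij_inv_eq_iff)+
  moreover have "inv \<tau> i = inv \<tau> j \<longleftrightarrow> i = j" for i j
    using assms by (metis bij_inv_eq_iff)
  ultimately show "relabel_matrix \<tau> ** conj_transpose (relabel_matrix \<tau>) = mat 1"
    by (auto simp: vec_eq_iff matrix_mult_nth mat_nth relabel_matrix_def
      if_distrib[of cnj] if_distrib[of "\<lambda>x. _ * x"] if_distrib[of "\<lambda>x. x * _"] cong: if_cong)
qed

lemma tensor_cube_relabel_matrix:
  "tensor_cube (relabel_matrix \<tau>) $ k $ i = (if k = \<tau> \<circ> i then 1 else 0)"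
proof (cases "k = \<tau> \<circ> i")
  case False
  then obtain x where "k x \<noteq> \<tau> (i x)" by (auto simp: fun_eq_iff)
  then have "\<exists>x\<in>UNIV. relabel_matrix \<tau> $ k x $ i x = 0" by (auto simp: relabel_matrix_def)
  with False show ?thesis by (simp add: tensor_cube_nth)
qed (simp add: tensor_cube_nth relabel_matrix_def)

text \<open>A relabelling unitary permutes the basis triples, so in row
  \<open>\<tau> \<circ> k\<close> and column \<open>i\<close> each side of the commutation relation
  reduces to a single entry of \<open>M\<close>.\<close>

lemma commutes_relabel:
  assumes "commutes_with_cubes M" "bij \<tau>"
  shows "M $ (\<tau> \<circ> k) $ (\<tau> \<circ> i) = M $ k $ i"
proof -
  let ?T = "tensor_cube (relabel_matrix \<tau>)"
  have *: "\<tau> \<circ> k = \<tau> \<circ> j \<longleftrightarrow> j = k" for j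
    using assms(2) by (auto simp: fun_eq_iff bij_def inj_eq)
  have "(?T ** M) $ (\<tau> \<circ> k) $ i = (M ** ?T) $ (\<tau> \<circ> k) $ i"
    by (rule commutes_with_cubesD[OF assms(1) relabel_matrix_unitary[OF assms(2)]])
  then show ?thesis
    by (simp add: matrix_mult_nth tensor_cube_relabel_matrix *
      if_distrib[of "\<lambda>x. _ * x"] if_distrib[of "\<lambda>x. x * _"] cong: if_cong)
qed

section \<open>Hadamard matrices on a coordinate plane\<close>

definition hadamard_matrix :: "'d \<Rightarrow> 'd \<Rightarrow> complex^'d::finite^'d" where
  "hadamard_matrix a b = (\<chi> i j.
     if j = a then if i = a \<or> i = b then 1 / sqrt 2 else 0
     else if j = b then if i = a then 1 / sqrt 2 else if i = b then - (1 / sqrt 2) else 0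
     else if i = j then 1 else 0)"

lemma sum_hadamard_matrix:
  fixes f :: "'d::finite \<Rightarrow> complex"
  assumes "a \<noteq> b"
  shows "(\<Sum>u\<in>UNIV. f u * hadamard_matrix a b $ u $ j)
    = (if j = a then (f a + f b) / sqrt 2 else if j = b then (f a - f b) / sqrt 2 else f j)"
proof -
  \<comment> \<open>Written as sums of single-index indicators, so that each sum over
    \<open>u\<close> collapses to one term.\<close>
  have "hadamard_matrix a b $ u $ j = (if j = a then (if u = a then 1 / complex_of_real (sqrt 2) else 0) + (if u = b then 1 / complex_of_real (sqrt 2) else 0)
    else if j = b then (if u = a then 1 / complex_of_real (sqrt 2) else 0) - (if u = b then 1 / complex_of_real (sqrt 2) else 0)
    else if u = j then 1 else 0)" for u
    using assms by (simp add: hadamard_matrix_def)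
  then show ?thesis
    by (simp add: distrib_left right_diff_distrib sum.distrib sum_subtractf
        if_distrib[of "\<lambda>x. _ * x"] add_divide_distrib diff_divide_distrib cong: if_cong)
qed

text \<open>The matrix is real and symmetric, so unitarity amounts to its square being the
  identity.\<close>

lemma hadamard_matrix_unitary:
  assumes "a \<noteq> b" shows "hadamard_matrix a b \<in> unitary_group"
proof (rule unitary_groupI)
  have "conj_transpose (hadamard_matrix a b) = hadamard_matrix a b"
    by (auto simp: vec_eq_iff hadamard_matrix_def)
  then show "hadamard_matrix a b ** conj_transpose (hadamard_matrix a b) = mat 1"
    using assms
    by (auto simp: vec_eq_iff matrix_mult_nth sum_hadamard_matrix mat_nth)
      (auto simp: hadamard_matrix_def complex_eq_iff field_simps)
qed

section \<open>Coordinates of index triples\<close>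

definition tri :: "'d \<Rightarrow> 'd \<Rightarrow> 'd \<Rightarrow> 3 \<Rightarrow> 'd" where
  "tri a b c = (\<lambda>x. if x = 1 then a else if x = 2 then b else c)"

lemma tri_simps [simp]: "tri a b c 1 = a" "tri a b c 2 = b" "tri a b c 3 = c"
  by (simp_all add: tri_def)

lemma tri_eta: "tri (i 1) (i 2) (i 3) = i"
  by (simp add: fun_eq_iff forall_3)

lemma inj_tri: "inj (tri a b c) \<longleftrightarrow> a \<noteq> b \<and> a \<noteq> c \<and> b \<noteq> c"
  by (auto simp: inj_def forall_3)

lemma card_tri_eq:
  "card {x. tri a b c x = d} = (if a = d then 1 else 0) + (if b = d then 1 else 0) + (if c = d then 1 else 0)"
proof -
  have "card {x. tri a b c x = d} = (\<Sum>x\<in>UNIV. if tri a b c x = d then 1 else 0)"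
    by (simp add: sum.If_cases)
  then show ?thesis by (simp add: sum_3)
qed

lemma sum_tri:
  fixes f :: "(3 \<Rightarrow> 'd::finite) \<Rightarrow> 'a::comm_monoid_add"
  shows "(\<Sum>i\<in>UNIV. f i) = (\<Sum>a\<in>UNIV. \<Sum>b\<in>UNIV. \<Sum>c\<in>UNIV. f (tri a b c))"
proof -
  have "bij (\<lambda>(a, b, c). tri a b (c::'d))"
    by (rule bij_betw_byWitness[where f' = "\<lambda>i. (i 1, i 2, i 3)"]) (auto simp: tri_eta)
  then have "(\<Sum>i\<in>UNIV. f i) = (\<Sum>(a, b, c)\<in>UNIV. f (tri a b c))"
    by (subst sum.reindex_bij_betw[symmetric]) (auto simp: case_prod_unfold)
  then show ?thesis
    by (simp add: sum.cartesian_product)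
qed

text \<open>The sums are nested so that each has the form summed in
  \<open>sum_hadamard_matrix\<close>, which can then be applied three times.\<close>

lemma mult_tensor_cube_tri:
  "(M ** tensor_cube V) $ k $ tri x y z
    = (\<Sum>u\<in>UNIV. (\<Sum>v\<in>UNIV. (\<Sum>w\<in>UNIV. M $ k $ tri u v w * V $ w $ z) * V $ v $ y) * V $ u $ x)"
  unfolding matrix_mult_nth sum_tri tensor_cube_nth UNIV_3
  by (simp add: sum_distrib_left mult_ac)

text \<open>If \<open>M\<close> kills the basis vector \<open>e_i\<close> and \<open>T\<close> is
  the cube, then \<open>M T e_i = T M e_i = 0\<close>. Expanding \<open>T e_i\<close> yields linear
  relations between other columns of \<open>M\<close>.\<close>

lemma commutes_hadamard:
  assumes "commutes_with_cubes M" "a \<noteq> b" "\<And>k. M $ k $ i = 0"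
  shows "(M ** tensor_cube (hadamard_matrix a b)) $ k $ i = 0"
proof -
  have "(tensor_cube (hadamard_matrix a b) ** M) $ k $ i = 0"
    by (simp add: matrix_mult_nth assms(3))
  then show ?thesis
    using commutes_with_cubesD[OF assms(1) hadamard_matrix_unitary[OF assms(2)]] by metis
qed

text \<open>A common nonzero value would give both \<open>i\<close> and \<open>j\<close> the same
  count of \<open>a\<close> as \<open>k\<close>.\<close>

lemma commutes_weight_separates:
  assumes "commutes_with_cubes M" "M $ k $ i = M $ k $ j"
    and "card {x. i x = a} \<noteq> card {x. j x = a}"
  shows "M $ k $ i = 0"
  using commutes_count[OF assms(1), of k i a] commutes_count[OF assms(1), of k j a] assms(2,3)
  by fastforce

text \<open>Since \<open>(e\<^sub>a + e\<^sub>b) \<otimes> (e\<^sub>a - e\<^sub>b) \<otimes> e\<^sub>c\<close> is killed, so is \<open>e\<^sub>a \<otimes> e\<^sub>a \<otimes> e\<^sub>c - e\<^sub>b \<otimes> e\<^sub>b \<otimes> e\<^sub>c\<close>,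
  whose two summands have images of different weights.\<close>

lemma commutes_eq_0:
  fixes M :: "'d::finite op3"
  assumes M: "commutes_with_cubes M" and card: "CARD('d) \<ge> 3"
    and inj: "\<And>i k. inj i \<Longrightarrow> M $ k $ i = 0"
  shows "M = 0"
proof -
  let ?F = "\<lambda>k a b c. M $ k $ tri a b c"
  have distinct: "?F k a b c = 0" if "a \<noteq> b" "a \<noteq> c" "b \<noteq> c" for k a b c
    using inj[of "tri a b c"] that by (simp add: inj_tri)
  \<comment> \<open>Dimension at least 3 provides an auxiliary index outside any given pair.\<close>
  have ex: "\<exists>c. c \<noteq> a \<and> c \<noteq> b" for a b :: 'd
  proof (rule ccontr)
    assume "\<not> ?thesis"
    then have "UNIV = {a, b}" by auto
    then have "CARD('d) = card {a, b}" by (rule arg_cong)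
    also have "\<dots> \<le> 2" by (simp add: card_insert_if)
    finally have "CARD('d) \<le> 2" .
    with card show False by simp
  qed
  define h where "h a b g j = (if j = a then (g a + g b) / sqrt 2 else if j = b then (g a - g b) / sqrt 2 else g j)"
    for a b j :: 'd and g :: "'d \<Rightarrow> complex"
  \<comment> \<open>The relation from \<open>commutes_hadamard\<close> at column
    \<open>x y z\<close>, with one application of \<open>h\<close> per tensor factor.\<close>
  have had: "h a b (\<lambda>u. h a b (\<lambda>v. h a b (\<lambda>w. ?F k u v w) z) y) x = 0"
    if "a \<noteq> b" "\<And>k. ?F k x y z = 0" for a b k x y z
    using commutes_hadamard[OF M that, of k] that(1)
    unfolding mult_tensor_cube_tri sum_hadamard_matrix[OF that(1)] h_def by simp
  have sep: "?F k a b c = 0"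
    if "?F k a b c = ?F k a' b' c'" "card {x. tri a b c x = e} \<noteq> card {x. tri a' b' c' x = e}"
    for k a b c a' b' c' e
    using commutes_weight_separates[OF M that] .
  have two: "?F k a a c = 0" "?F k a c a = 0" "?F k c a a = 0" if "a \<noteq> c" for k a c
  proof -
    obtain b where b: "b \<noteq> a" "b \<noteq> c" using ex by blast
    \<comment> \<open>In the expansion of \<open>(e_a + e_b) (e_a - e_b) e_c\<close> the mixed
      triples have distinct entries and drop out. The next two cases put \<open>c\<close> in the
      other positions.\<close>
    have "?F k a a c = ?F k b b c"
      using had[of a b a b c k] b that
      by (simp add: distinct h_def diff_divide_distrib add_divide_distrib)
    moreover have "?F k a c a = ?F k b c b"
      using had[of a b a c b k] b that
      by (simp add: distinct h_def diff_divide_distrib add_divide_distrib)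
    moreover have "?F k c a a = ?F k c b b"
      using had[of a b c a b k] b that
      by (simp add: distinct h_def diff_divide_distrib add_divide_distrib)
    \<comment> \<open>The separating index is \<open>a\<close>, which occurs twice in one triple and
      never in the other.\<close>
    ultimately show "?F k a a c = 0" "?F k a c a = 0" "?F k c a a = 0"
      using sep[of k a a c b b c a] sep[of k a c a b c b a] sep[of k c a a c b b a] b that
      by (simp_all add: card_tri_eq)
  qed
  have three: "?F k a a a = 0" for k a
  proof -
    obtain b where b: "b \<noteq> a" using ex by blast
    \<comment> \<open>In \<open>(e_a + e_b) (e_a + e_b) (e_a - e_b)\<close> every mixed triple has
      exactly two equal entries and vanishes by \<open>two\<close>; the two constant triples remain,
      with opposite signs.\<close>
    then have "?F k a a a = ?F k b b b"
      using had[of a b a a b k] by (simp add: two h_def diff_divide_distrib add_divide_distrib)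
    then show ?thesis
      using sep[of k a a a b b b a] b by (simp add: card_tri_eq)
  qed
  have "?F k a b c = 0" for k a b c
    by (cases "a = b"; cases "a = c"; cases "b = c") (auto simp: distinct two three)
  then have "M $ k $ i = 0" for k i
    by (metis tri_eta)
  then show ?thesis
    by (simp add: vec_eq_iff)
qed

section \<open>Injective indices and permutations\<close>

lemma finite_inj_transitive:
  fixes i j :: "'a \<Rightarrow> 'b::finite"
  assumes "inj i" "inj j"
  obtains \<tau> where "bij \<tau>" "j = \<tau> \<circ> i"
proof -
  have f: "bij_betw (j \<circ> inv i) (range i) (range j)"
    by (intro bij_betw_trans[OF bij_betw_inv_into[of i UNIV]] bij_betw_imageI assms refl)
  \<comment> \<open>The map \<open>j \<circ> inv i\<close> matches the ranges. By finiteness their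
    complements have equal size, so any bijection \<open>g\<close> between these completes it to a
    permutation.\<close>
  then have "card (- range i) = card (- range j)"
    using bij_betw_same_card[OF f] by (simp add: Compl_eq_Diff_UNIV card_Diff_subset)
  then obtain g where g: "bij_betw g (- range i) (- range j)"
    by (metis finite finite_same_card_bij)
  let ?\<tau> = "\<lambda>x. if x \<in> range i then (j \<circ> inv i) x else g x"
  have "bij ?\<tau>"
    using bij_betw_disjoint_Un[OF f g] by (simp add: Compl_eq_Diff_UNIV)
  moreover have "j = ?\<tau> \<circ> i"
    using assms by (auto simp: fun_eq_iff)
  ultimately show thesis by (rule that)
qed

text \<open>The fibres of \<open>i\<close> have at most one element. Equal counts then make
  \<open>k\<close> injective with values in \<open>range i\<close>, so \<open>k\<close> rearranges
  \<open>i\<close>.\<close>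

lemma equal_fibers_permutes:
  fixes i k :: "3 \<Rightarrow> 'd::finite"
  assumes "inj i" "\<And>a. card {x. k x = a} = card {x. i x = a}"
  obtains \<pi> where "bij \<pi>" "k = i \<circ> inv \<pi>"
proof -
  have i: "card {x. i x = a} \<le> 1" for a
    using assms(1) by (auto simp: card_le_Suc0_iff_eq inj_def)
  have "inj k"
  proof (rule injI)
    fix x y assume "k x = k y"
    then have "card {x, y} \<le> card {z. k z = k x}" by (intro card_mono) auto
    also have "\<dots> \<le> 1" using assms(2) i by simp
    finally show "x = y" by (cases "x = y") auto
  qed
  have "range k \<subseteq> range i"
  proof (intro image_subsetI)
    fix x
    have "{z. k z = k x} \<noteq> {}" by auto
    then have "card {z. i z = k x} \<noteq> 0" by (metis assms(2) card_0_eq finite)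
    then show "k x \<in> range i" by (metis (mono_tags, lifting) Collect_empty_eq card.empty rangeI)
  qed
  then have k: "i \<circ> (inv i \<circ> k) = k"
    by (auto simp: fun_eq_iff intro!: f_inv_into_f)
  with \<open>inj k\<close> have "inj (inv i \<circ> k)"
    by (metis inj_on_imageI2)
  then have "bij (inv i \<circ> k)"
    by (intro bijI finite_UNIV_inj_surj finite)
  \<comment> \<open>The inverse is taken because the required form contains
    \<open>inv \<pi>\<close>.\<close>
  with k that[of "inv (inv i \<circ> k)"] show thesis
    by (simp add: bij_imp_bij_inv inv_inv_eq)
qed

section \<open>The span of the permutation operators\<close>

lemma commutes_with_cubes_perm_op: "bij \<pi> \<Longrightarrow> commutes_with_cubes (perm_op \<pi>)"
  by (simp add: commutes_with_cubes_def tensor_cube_perm_op_commute)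

lemma S3_iff: "\<pi> \<in> S3 \<longleftrightarrow> bij \<pi>"
  by (auto simp: S3_def permutes_bij intro: bij_imp_permutes)

lemma commutes_with_cubes_diff:
  assumes "commutes_with_cubes M" "commutes_with_cubes N"
  shows "commutes_with_cubes (M - N)"
proof -
  have "X ** (M - N) = X ** M - X ** N" "(M - N) ** X = M ** X - N ** X" for X
    by (simp_all add: vec_eq_iff matrix_mult_nth algebra_simps sum_subtractf)
  then show ?thesis
    using assms unfolding commutes_with_cubes_def by metis
qed

lemma mult_sum_cscale:
  "X ** (\<Sum>s\<in>S. m s *\<^sub>M f s) = (\<Sum>s\<in>S. m s *\<^sub>M (X ** f s))"
  "(\<Sum>s\<in>S. m s *\<^sub>M f s) ** X = (\<Sum>s\<in>S. m s *\<^sub>M (f s ** X))"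
  by (simp_all add: vec_eq_iff matrix_mult_nth sum_distrib_left sum_distrib_right mult_ac)
    (auto intro: sum.swap)

lemma commutes_with_cubes_sum_cscale:
  assumes "\<And>s. s \<in> S \<Longrightarrow> commutes_with_cubes (f s)"
  shows "commutes_with_cubes (\<Sum>s\<in>S. m s *\<^sub>M f s)"
  using assms unfolding commutes_with_cubes_def mult_sum_cscale
  by (auto intro!: sum.cong arg_cong[where f = "cscale _"])

theorem commutant_tensor_cube:
  fixes M :: "'d::finite op3"
  assumes M: "commutes_with_cubes M" and card: "CARD('d) \<ge> 3"
  obtains m where "M = (\<Sum>\<pi>\<in>S3. m \<pi> *\<^sub>M perm_op \<pi>)"
proof -
  obtain i0 :: "3 \<Rightarrow> 'd" where i0: "inj i0"
    using card_le_inj[of "UNIV :: 3 set" "UNIV :: 'd set"] card by auto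
  \<comment> \<open>In column \<open>i0\<close>, whose entries are distinct, different
    \<open>perm_op \<pi>\<close> have their only 1 in different rows
    \<open>i0 \<circ> inv \<pi>\<close>, so this column alone determines the coefficients.\<close>
  define m where "m \<pi> = M $ (i0 \<circ> inv \<pi>) $ i0" for \<pi>
  let ?N = "M - (\<Sum>\<pi>\<in>S3. m \<pi> *\<^sub>M perm_op \<pi>)"
  have N: "commutes_with_cubes ?N"
    by (intro commutes_with_cubes_diff commutes_with_cubes_sum_cscale
        commutes_with_cubes_perm_op M) (simp add: S3_iff)
  have "?N $ k $ i = 0" if i: "inj i" for i k
  proof (rule ccontr)
    assume "?N $ k $ i \<noteq> 0"
    then have "card {x. k x = a} = card {x. i x = a}" for a
      by (rule commutes_count[OF N])
    then obtain \<pi> where \<pi>: "bij \<pi>" "k = i \<circ> inv \<pi>"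
      by (rule equal_fibers_permutes[OF i])
    obtain \<tau> where \<tau>: "bij \<tau>" "i = \<tau> \<circ> i0"
      using finite_inj_transitive[OF i0 i] .
    \<comment> \<open>Relabelling by \<open>\<tau>\<close> carries the reference column
      \<open>i0\<close> to \<open>i\<close>, so the coefficient found there is also correct
      here.\<close>
    have M: "M $ k $ i = m \<pi>"
      unfolding m_def \<pi>(2) \<tau>(2) comp_assoc by (rule commutes_relabel[OF M \<tau>(1)])
    \<comment> \<open>Since \<open>i\<close> is injective, only the summand at \<open>\<pi>\<close>
      has a nonzero entry in row \<open>k\<close>.\<close>
    have *: "i \<circ> inv \<pi> = i \<circ> inv \<rho> \<longleftrightarrow> \<rho> = \<pi>" if "bij \<rho>" for \<rho>
      using inj_eq[OF fun.inj_map[OF i]] inv_inv_eq[OF \<pi>(1)] inv_inv_eq[OF that] by metis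
    have "(\<Sum>\<rho>\<in>S3. m \<rho> *\<^sub>M perm_op \<rho>) $ k $ i = (\<Sum>\<rho>\<in>S3. m \<rho> * perm_op \<rho> $ k $ i)"
      by simp
    also have "\<dots> = (\<Sum>\<rho>\<in>S3. if \<rho> = \<pi> then m \<rho> else 0)"
      using * by (intro sum.cong) (auto simp: \<pi>(2) perm_op_def S3_iff)
    also have "\<dots> = m \<pi>"
      using \<pi>(1) by (simp add: S3_iff)
    finally show False
      using M \<open>?N $ k $ i \<noteq> 0\<close> by simp
  qed
  then have "?N = 0"
    by (rule commutes_eq_0[OF N card])
  then show thesis
    by (intro that[of m]) simp
qed

section \<open>Invariant integration\<close>

text \<open>Each row of a unitary matrix has Euclidean norm 1.\<close>

lemma unitary_group_entry_le:
  assumes "U \<in> unitary_group" shows "norm (U $ i $ j) \<le> 1"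
proof -
  have "(U ** conj_transpose U) $ i $ i = 1"
    using assms by (simp add: unitary_group_def mat_nth)
  then have "complex_of_real (\<Sum>k\<in>UNIV. (norm (U $ i $ k))\<^sup>2) = 1"
    by (simp add: matrix_mult_nth complex_norm_square del: of_real_power)
  then have "(\<Sum>k\<in>UNIV. (norm (U $ i $ k))\<^sup>2) = 1"
    by (simp only: of_real_eq_1_iff)
  moreover have "(norm (U $ i $ j))\<^sup>2 \<le> (\<Sum>k\<in>UNIV. (norm (U $ i $ k))\<^sup>2)"
    by (rule member_le_sum) auto
  ultimately show ?thesis
    using power_le_imp_le_base[of "norm (U $ i $ j)" 1 1] by (simp add: power2_eq_square abs_square_le_1)
qed

lemma mult_entrywise_integral:
  assumes "\<And>i j. integrable \<mu> (\<lambda>U. F U $ i $ j)"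
  shows "X ** entrywise_integral \<mu> F = entrywise_integral \<mu> (\<lambda>U. X ** F U)"
    and "entrywise_integral \<mu> F ** X = entrywise_integral \<mu> (\<lambda>U. F U ** X)"
  using assms by (simp_all add: vec_eq_iff entrywise_integral_def matrix_mult_nth)

lemma trace_entrywise_integral:
  assumes "\<And>i j. integrable \<mu> (\<lambda>U. F U $ i $ j)"
  shows "trace (entrywise_integral \<mu> F) = (\<integral>U. trace (F U) \<partial>\<mu>)"
  using assms by (simp add: entrywise_integral_def trace_def)

section \<open>The twirl over the Haar measure\<close>

context
  fixes \<mu> :: "(complex^'d^'d) measure"
  assumes haar: "normalized_haar_unitary \<mu>"
begin

lemma prob_space_haar: "prob_space \<mu>"
  and space_haar: "space \<mu> = unitary_group"
  and sets_haar: "sets \<mu> = sets (restrict_space borel unitary_group)"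
  and emeasure_haar: "V \<in> unitary_group \<Longrightarrow> B \<in> sets \<mu> \<Longrightarrow> emeasure \<mu> ((**) V ` B) = emeasure \<mu> B"
  using haar by (auto simp: normalized_haar_unitary_def)

lemma measurable_entry_haar: "(\<lambda>U. U $ i $ j) \<in> borel_measurable \<mu>"
proof -
  have "(\<lambda>U::complex^'d^'d. U $ i $ j) \<in> borel_measurable borel"
    by (intro borel_measurable_continuous_onI continuous_intros)
  then show ?thesis
    by (simp add: measurable_restrict_space1 cong: measurable_cong_sets[OF sets_haar refl])
qed

text \<open>Each entry is a finite linear combination of products of a cube entry and a conjugated
  one; these are measurable and bounded by 1 on a probability space.\<close>

lemma integrable_haar:
  "integrable \<mu> (\<lambda>U. (tensor_cube U ** A ** conj_transpose (tensor_cube U)) $ k $ l)"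
proof -
  interpret prob_space \<mu> by (rule prob_space_haar)
  have meas: "(\<lambda>U. tensor_cube U $ i $ j) \<in> borel_measurable \<mu>" for i j
    unfolding tensor_cube_nth by (intro borel_measurable_prod measurable_entry_haar)
  have bound: "norm (tensor_cube U $ i $ j) \<le> 1" if "U \<in> space \<mu>" for U i j
    using that unitary_group_entry_le
    by (auto simp: tensor_cube_nth space_haar simp flip: prod_norm intro!: prod_le_1)
  have "integrable \<mu> (\<lambda>U. tensor_cube U $ k $ i * cnj (tensor_cube U $ l $ j))" for i j
  proof (rule integrable_const_bound[where B = 1])
    show "AE U in \<mu>. norm (tensor_cube U $ k $ i * cnj (tensor_cube U $ l $ j)) \<le> 1"
      using bound by (intro AE_I2) (simp add: norm_mult mult_le_one)
    show "(\<lambda>U. tensor_cube U $ k $ i * cnj (tensor_cube U $ l $ j)) \<in> borel_measurable \<mu>"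
      by (intro borel_measurable_times meas measurable_compose[OF meas, of cnj borel]
          borel_measurable_continuous_onI continuous_intros)
  qed
  then have "integrable \<mu> (\<lambda>U. \<Sum>j\<in>UNIV. \<Sum>i\<in>UNIV. A $ i $ j * (tensor_cube U $ k $ i * cnj (tensor_cube U $ l $ j)))"
    by (intro Bochner_Integration.integrable_sum Bochner_Integration.integrable_mult_right) auto
  then show ?thesis
    by (simp add: matrix_mult_nth sum_distrib_left mult_ac)
qed

lemma measurable_mult_haar:
  assumes "V \<in> unitary_group" shows "(**) V \<in> measurable \<mu> \<mu>"
proof -
  have "(**) V \<in> borel_measurable borel"
    unfolding matrix_matrix_mult_def by (intro borel_measurable_continuous_onI continuous_intros)
  then have "(**) V \<in> measurable (restrict_space borel unitary_group) (restrict_space borel unitary_group)"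
    using unitary_group_mult[OF assms]
    by (intro measurable_restrict_space2 measurable_restrict_space1) (auto simp: space_restrict_space)
  then show ?thesis
    by (simp cong: measurable_cong_sets[OF sets_haar sets_haar])
qed

text \<open>The Haar property concerns translates, the pushforward concerns preimages; the preimage
  under \<open>V\<close> is the translate by \<open>conj_transpose V\<close>.\<close>

lemma distr_mult_haar:
  assumes V: "V \<in> unitary_group" shows "distr \<mu> \<mu> ((**) V) = \<mu>"
proof (rule measure_eqI)
  fix B assume "B \<in> sets (distr \<mu> \<mu> ((**) V))"
  then have B: "B \<in> sets \<mu>" by simp
  then have "B \<subseteq> unitary_group"
    using sets.sets_into_space space_haar by metis
  moreover have inv: "conj_transpose V ** (V ** U) = U" "V ** (conj_transpose V ** U) = U" for U :: "complex^'d^'d"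
    using V by (auto simp: matrix_mul_assoc unitary_group_def)
  ultimately have "(**) V -` B \<inter> space \<mu> = (**) (conj_transpose V) ` B"
    using unitary_group_mult[OF unitary_group_conj_transpose[OF V]]
    by (auto simp: space_haar intro: rev_image_eqI)
  then show "emeasure (distr \<mu> \<mu> ((**) V)) B = emeasure \<mu> B"
    by (simp add: emeasure_distr measurable_mult_haar[OF V] B
        emeasure_haar[OF unitary_group_conj_transpose[OF V] B])
qed simp

lemma entrywise_integral_haar_shift:
  assumes "V \<in> unitary_group" and "\<And>i j. (\<lambda>U. F U $ i $ j) \<in> borel_measurable \<mu>"
  shows "entrywise_integral \<mu> (\<lambda>U. F (V ** U)) = entrywise_integral \<mu> F"
proof -
  have "(\<integral>U. F (V ** U) $ i $ j \<partial>\<mu>) = (\<integral>U. F U $ i $ j \<partial>\<mu>)" for i j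
    using integral_distr[OF measurable_mult_haar[OF assms(1)] assms(2)[of i j]]
    by (simp add: distr_mult_haar[OF assms(1)])
  then show ?thesis by (simp add: entrywise_integral_def)
qed

text \<open>Replacing \<open>U\<close> by \<open>V ** U\<close> conjugates the integrand by the cube
  of \<open>V\<close>, while invariance leaves the integral unchanged.\<close>

lemma twirl_commutes:
  "commutes_with_cubes
     (entrywise_integral \<mu> (\<lambda>U. tensor_cube U ** A ** conj_transpose (tensor_cube U)))"
  unfolding commutes_with_cubes_def
proof
  fix V :: "complex^'d^'d" assume V: "V \<in> unitary_group"
  let ?F = "\<lambda>U. tensor_cube U ** A ** conj_transpose (tensor_cube U)" and ?T = "tensor_cube V"
  have F: "?F (V ** U) = ?T ** ?F U ** conj_transpose ?T" for U
    by (simp add: tensor_cube_mult conj_transpose_mult matrix_mul_assoc)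
  \<comment> \<open>The shifted integrand is integrable because the pushforward of
    \<open>\<mu>\<close> under \<open>V\<close> is \<open>\<mu>\<close> itself.\<close>
  have "integrable \<mu> (\<lambda>U. ?F (V ** U) $ i $ j)" for i j
    by (rule integrable_distr[of _ _ \<mu>])
      (simp_all add: distr_mult_haar V measurable_mult_haar integrable_haar)
  then have "entrywise_integral \<mu> (\<lambda>U. ?F (V ** U)) ** ?T = entrywise_integral \<mu> (\<lambda>U. ?F (V ** U) ** ?T)"
    by (rule mult_entrywise_integral)
  also have "(\<lambda>U. ?F (V ** U) ** ?T) = (\<lambda>U. ?T ** ?F U)"
    unfolding F by (simp add: tensor_cube_unitary[OF V] flip: matrix_mul_assoc)
  also have "entrywise_integral \<mu> \<dots> = ?T ** entrywise_integral \<mu> ?F"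
    by (rule mult_entrywise_integral[symmetric]) (rule integrable_haar)
  finally show "?T ** entrywise_integral \<mu> ?F = entrywise_integral \<mu> ?F ** ?T"
    using entrywise_integral_haar_shift[OF V, of ?F] integrable_haar[of A] by simp
qed

text \<open>Since \<open>perm_op \<pi>\<close> commutes with cubes, cyclicity of the trace makes the
  integrand constant, and the total mass is 1.\<close>

lemma trace_twirl_perm_op:
  assumes "bij \<pi>"
  shows "trace (entrywise_integral \<mu> (\<lambda>U. tensor_cube U ** A ** conj_transpose (tensor_cube U)) ** perm_op \<pi>)
    = trace (A ** perm_op \<pi>)"
proof -
  interpret prob_space \<mu> by (rule prob_space_haar)
  let ?F = "\<lambda>U. tensor_cube U ** A ** conj_transpose (tensor_cube U)"
  have "trace (entrywise_integral \<mu> ?F ** perm_op \<pi>) = trace (entrywise_integral \<mu> (\<lambda>U. ?F U ** perm_op \<pi>))"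
    by (subst mult_entrywise_integral) (rule integrable_haar, rule refl)
  also have "\<dots> = (\<integral>U. trace (?F U ** perm_op \<pi>) \<partial>\<mu>)"
    by (rule trace_entrywise_integral) (simp add: mult_perm_op_nth integrable_haar)
  also have "\<dots> = (\<integral>U. trace (A ** perm_op \<pi>) \<partial>\<mu>)"
  proof (rule Bochner_Integration.integral_cong[OF refl])
    fix U assume "U \<in> space \<mu>"
    then have U: "U \<in> unitary_group" by (simp add: space_haar)
    have "?F U ** perm_op \<pi> = tensor_cube U ** (A ** perm_op \<pi> ** conj_transpose (tensor_cube U))"
      using tensor_cube_perm_op_commute[OF assms, of "conj_transpose U"]
      by (simp add: tensor_cube_conj_transpose flip: matrix_mul_assoc)
    then have "trace (?F U ** perm_op \<pi>) = trace (A ** perm_op \<pi> ** conj_transpose (tensor_cube U) ** tensor_cube U)"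
      by (metis trace_mul_sym)
    then show "trace (?F U ** perm_op \<pi>) = trace (A ** perm_op \<pi>)"
      by (simp add: tensor_cube_unitary[OF U] flip: matrix_mul_assoc)
  qed
  also have "\<dots> = trace (A ** perm_op \<pi>)"
    by (simp add: prob_space)
  finally show ?thesis .
qed

end

section \<open>The Weingarten matrix\<close>

declare One_nat_def [simp del]

section \<open>The symmetric group on three points\<close>

lemma s3_apply:
  "s3 1 1 = 1" "s3 1 2 = 2" "s3 1 3 = 3"
  "s3 2 1 = 2" "s3 2 2 = 1" "s3 2 3 = 3"
  "s3 3 1 = 3" "s3 3 2 = 2" "s3 3 3 = 1"
  "s3 4 1 = 1" "s3 4 2 = 3" "s3 4 3 = 2"
  "s3 5 1 = 2" "s3 5 2 = 3" "s3 5 3 = 1"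
  "s3 6 1 = 3" "s3 6 2 = 1" "s3 6 3 = 2"
  by (simp_all add: s3_def Transposition.transpose_def)

lemma s3_eq_iff: "s3 i = s3 j \<longleftrightarrow> s3 i 1 = s3 j 1 \<and> s3 i 2 = s3 j 2 \<and> s3 i 3 = s3 j 3"
  by (simp add: fun_eq_iff forall_3)

lemma distinct_s3: "distinct (map s3 [1, 2, 3, 4, 5, 6])"
  by (simp add: s3_eq_iff s3_apply)

lemma s3_comp_iff:
  "s3 i \<circ> s3 j = s3 k \<longleftrightarrow> s3 i (s3 j 1) = s3 k 1 \<and> s3 i (s3 j 2) = s3 k 2 \<and> s3 i (s3 j 3) = s3 k 3"
  by (simp add: fun_eq_iff forall_3)

lemma s3_comp:
  "s3 1 \<circ> s3 1 = s3 1" "s3 1 \<circ> s3 2 = s3 2" "s3 1 \<circ> s3 3 = s3 3" "s3 1 \<circ> s3 4 = s3 4" "s3 1 \<circ> s3 5 = s3 5" "s3 1 \<circ> s3 6 = s3 6"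
  "s3 2 \<circ> s3 1 = s3 2" "s3 2 \<circ> s3 2 = s3 1" "s3 2 \<circ> s3 3 = s3 6" "s3 2 \<circ> s3 4 = s3 5" "s3 2 \<circ> s3 5 = s3 4" "s3 2 \<circ> s3 6 = s3 3"
  "s3 3 \<circ> s3 1 = s3 3" "s3 3 \<circ> s3 2 = s3 5" "s3 3 \<circ> s3 3 = s3 1" "s3 3 \<circ> s3 4 = s3 6" "s3 3 \<circ> s3 5 = s3 2" "s3 3 \<circ> s3 6 = s3 4"
  "s3 4 \<circ> s3 1 = s3 4" "s3 4 \<circ> s3 2 = s3 6" "s3 4 \<circ> s3 3 = s3 5" "s3 4 \<circ> s3 4 = s3 1" "s3 4 \<circ> s3 5 = s3 3" "s3 4 \<circ> s3 6 = s3 2"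
  "s3 5 \<circ> s3 1 = s3 5" "s3 5 \<circ> s3 2 = s3 3" "s3 5 \<circ> s3 3 = s3 4" "s3 5 \<circ> s3 4 = s3 2" "s3 5 \<circ> s3 5 = s3 6" "s3 5 \<circ> s3 6 = s3 1"
  "s3 6 \<circ> s3 1 = s3 6" "s3 6 \<circ> s3 2 = s3 4" "s3 6 \<circ> s3 3 = s3 2" "s3 6 \<circ> s3 4 = s3 3" "s3 6 \<circ> s3 5 = s3 1" "s3 6 \<circ> s3 6 = s3 5"
  by (simp_all only: s3_comp_iff s3_apply simp_thms)

lemma s3_1: "s3 1 = id"
  by (simp add: s3_def)

lemma inv_s3:
  "inv (s3 1) = s3 1" "inv (s3 2) = s3 2" "inv (s3 3) = s3 3"
  "inv (s3 4) = s3 4" "inv (s3 5) = s3 6" "inv (s3 6) = s3 5"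
  by (rule inv_unique_comp; simp only: s3_comp; simp only: s3_1)+

text \<open>The six listed maps are bijections and distinct, and \<open>S3\<close> has
  \<open>3! = 6\<close> elements.\<close>

lemma S3_eq: "S3 = {s3 1, s3 2, s3 3, s3 4, s3 5, s3 6}"
proof (rule card_subset_eq[symmetric])
  show "finite S3" by simp
  have "bij (s3 j)" if "j \<in> {1, 2, 3, 4, 5, 6}" for j
    by (rule o_bij[of "inv (s3 j)"])
      (use that in \<open>auto simp: inv_s3 fun_eq_iff forall_3 s3_apply\<close>)
  then show "{s3 1, s3 2, s3 3, s3 4, s3 5, s3 6} \<subseteq> S3"
    by (simp add: S3_iff)
  have "card S3 = 6"
    unfolding S3_def by (subst card_permutations[of _ 3]) (simp_all add: fact_numeral)
  moreover have "card {s3 1, s3 2, s3 3, s3 4, s3 5, s3 6} = 6"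
    using distinct_card[OF distinct_s3] by (simp only: set_map list.set image_insert image_empty length_map list.size)
  ultimately show "card {s3 1, s3 2, s3 3, s3 4, s3 5, s3 6} = card S3" by simp
qed

lemma atLeastAtMost_1_6: "{1..6::nat} = {1, 2, 3, 4, 5, 6}"
  by auto

lemma bij_s3: "j \<in> {1..6} \<Longrightarrow> bij (s3 j)"
  unfolding atLeastAtMost_1_6 S3_iff[symmetric] S3_eq by blast

lemma sum_S3: "(\<Sum>\<pi>\<in>S3. f \<pi>) = (\<Sum>j=1..6. f (s3 j))"
proof -
  have "inj_on s3 {1..6}"
    using distinct_s3 unfolding atLeastAtMost_1_6 by (auto simp: inj_on_def)
  moreover have "s3 ` {1..6} = S3"
    unfolding atLeastAtMost_1_6 S3_eq by simp
  ultimately show ?thesis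
    using sum.reindex[of s3 "{1..6}" f] by simp
qed

text \<open>A basis vector contributes 1 exactly when its index is constant on the cycles of the
  permutation, so the trace is the dimension to the power of the number of cycles.\<close>

lemma trace_perm_op_s3:
  "trace (perm_op (s3 1) :: 'd::finite op3) = of_nat CARD('d) ^ 3"
  "trace (perm_op (s3 2) :: 'd::finite op3) = of_nat CARD('d) ^ 2"
  "trace (perm_op (s3 3) :: 'd::finite op3) = of_nat CARD('d) ^ 2"
  "trace (perm_op (s3 4) :: 'd::finite op3) = of_nat CARD('d) ^ 2"
  "trace (perm_op (s3 5) :: 'd::finite op3) = of_nat CARD('d)"
  "trace (perm_op (s3 6) :: 'd::finite op3) = of_nat CARD('d)"
proof -
  \<comment> \<open>The fixed-index condition is split by coordinate and nested, so that the sums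
    collapse one at a time.\<close>
  have *: "trace (perm_op \<pi> :: 'd op3) = (\<Sum>a\<in>UNIV. \<Sum>b\<in>UNIV. \<Sum>c\<in>UNIV.
     if (a :: 'd) = tri a b c (inv \<pi> 1) then if b = tri a b c (inv \<pi> 2) then if c = tri a b c (inv \<pi> 3) then 1 else 0 else 0 else 0)" for \<pi>
    unfolding trace_def sum_tri
    by (intro sum.cong) (auto simp: perm_op_def fun_eq_iff forall_3)
  have pull: "(\<Sum>x\<in>UNIV. if P then f x else 0) = (if P then \<Sum>x\<in>UNIV. f x else 0)" for P and f :: "'d \<Rightarrow> complex"
    by simp
  show "trace (perm_op (s3 1) :: 'd op3) = of_nat CARD('d) ^ 3"
  "trace (perm_op (s3 2) :: 'd op3) = of_nat CARD('d) ^ 2"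
  "trace (perm_op (s3 3) :: 'd op3) = of_nat CARD('d) ^ 2"
  "trace (perm_op (s3 4) :: 'd op3) = of_nat CARD('d) ^ 2"
  "trace (perm_op (s3 5) :: 'd op3) = of_nat CARD('d)"
  "trace (perm_op (s3 6) :: 'd op3) = of_nat CARD('d)"
    unfolding * inv_s3 s3_apply tri_simps
    by (simp_all add: pull power2_eq_square power3_eq_cube)
qed

section \<open>Weingarten values and the Gram matrix\<close>

lemma conj_class_s3:
  "conj_class 1 = {s3 1}" "conj_class 2 = {s3 2, s3 3, s3 4}" "conj_class 3 = {s3 5, s3 6}"
  by (simp_all add: conj_class_def s3_def)

text \<open>The case distinction in \<open>weingarten3\<close> is constant on each class, so the
  image is a singleton and \<open>the_elem\<close> returns its value.\<close>

lemma Wg3_conj_class: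
  "Wg3 n (conj_class 1) = (of_nat n ^ 2 - 2)
    / ((of_nat n - 2) * (of_nat n - 1) * of_nat n * (of_nat n + 1) * (of_nat n + 2))"
  "Wg3 n (conj_class 2) =
    - (1 / ((of_nat n - 2) * (of_nat n - 1) * (of_nat n + 1) * (of_nat n + 2)))"
  "Wg3 n (conj_class 3) =
    2 / ((of_nat n - 2) * (of_nat n - 1) * of_nat n * (of_nat n + 1) * (of_nat n + 2))"
  by (simp_all add: Wg3_def weingarten3_def conj_class_s3 s3_eq_iff s3_apply Let_def)

text \<open>The convolution of the Weingarten function with \<open>D ^ cycles\<close> is the unit of
  the group algebra. Both are class functions, so one equation per class expresses this: at the
  identity, at a transposition and at a 3-cycle.\<close>

lemma Wg3_gram:
  fixes D W1 W2 W3 :: complex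
  assumes D: "D = of_nat n" and n: "n \<ge> 3"
    and W: "W1 = Wg3 n (conj_class 1)" "W2 = Wg3 n (conj_class 2)" "W3 = Wg3 n (conj_class 3)"
  shows "W1 * D ^ 3 + 3 * W2 * D\<^sup>2 + 2 * W3 * D = 1"
    and "W1 * D\<^sup>2 + W2 * D ^ 3 + 2 * W2 * D + 2 * W3 * D\<^sup>2 = 0"
    and "W1 * D + 3 * W2 * D\<^sup>2 + W3 * D ^ 3 + W3 * D = 0"
proof -
  \<comment> \<open>The bound \<open>n \<ge> 3\<close> keeps \<open>D\<close> away from the poles 0,
    1 and 2.\<close>
  have "D \<noteq> of_nat 0" "D \<noteq> of_nat 1" "D \<noteq> of_nat 2"
    unfolding D of_nat_eq_iff using n by auto
  moreover have "D + of_nat 1 \<noteq> of_nat 0" "D + of_nat 2 \<noteq> of_nat 0"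
    unfolding D of_nat_add[symmetric] of_nat_eq_iff by auto
  ultimately have nz: "D \<noteq> 0" "D - 1 \<noteq> 0" "D - 2 \<noteq> 0" "D + 1 \<noteq> 0" "D + 2 \<noteq> 0"
    by auto
  define P where "P = (D - 2) * (D - 1) * D * (D + 1) * (D + 2)"
  have P: "P \<noteq> 0" using nz by (simp add: P_def)
  have W': "W1 = (D\<^sup>2 - 2) / P" "W2 = - D / P" "W3 = 2 / P"
  proof -
    \<comment> \<open>Inserts the factor \<open>D\<close> that the denominator of \<open>W2\<close>
      lacks, to reach the common denominator \<open>P\<close>.\<close>
    have cancel: "- (1 / (a * b * e * f)) = - x / (a * b * x * e * f)" if "x \<noteq> 0" for a b e f x :: complex
      using that by simp
    show "W1 = (D\<^sup>2 - 2) / P" "W2 = - D / P" "W3 = 2 / P"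
      unfolding W Wg3_conj_class D[symmetric] P_def by (rule refl cancel[OF nz(1)])+
  qed
  have P_eq: "P = D * D * D * D * D - 5 * (D * D * D) + 4 * D"
    unfolding P_def by (simp add: algebra_simps)
  show "W1 * D ^ 3 + 3 * W2 * D\<^sup>2 + 2 * W3 * D = 1"
  proof -
    \<comment> \<open>The numerator is \<open>(D^2 - 2) * D^3 - 3 * D^3 + 4 * D\<close>, which is
      \<open>P\<close> expanded.\<close>
    have "W1 * D ^ 3 + 3 * W2 * D\<^sup>2 + 2 * W3 * D = (D * D * D * D * D - 5 * (D * D * D) + 4 * D) / P"
      using P unfolding W' by (simp add: field_simps power3_eq_cube power2_eq_square)
    then show ?thesis using P P_eq by simp
  qed
  show "W1 * D\<^sup>2 + W2 * D ^ 3 + 2 * W2 * D + 2 * W3 * D\<^sup>2 = 0"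
    using P unfolding W' by (simp add: field_simps power3_eq_cube power2_eq_square)
  show "W1 * D + 3 * W2 * D\<^sup>2 + W3 * D ^ 3 + W3 * D = 0"
    using P unfolding W' by (simp add: field_simps power3_eq_cube power2_eq_square)
qed

text \<open>This is row \<open>j\<close> of the Gram matrix applied to the coefficients
  \<open>m\<close>, by linearity of the trace and multiplicativity of
  \<open>perm_op\<close>.\<close>

lemma trace_sum_perm_op:
  fixes m :: "(3 \<Rightarrow> 3) \<Rightarrow> complex"
  assumes "j \<in> {1..6}"
  shows "trace ((\<Sum>\<pi>\<in>S3. m \<pi> *\<^sub>M (perm_op \<pi> :: 'd::finite op3)) ** perm_op (inv (s3 j)))
    = (\<Sum>k=1..6. m (s3 k) * trace (perm_op (s3 k \<circ> inv (s3 j)) :: 'd op3))"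
proof -
  have "trace (\<Sum>s\<in>S. n s *\<^sub>M f s) = (\<Sum>s\<in>S. n s * trace (f s))"
    for S :: "(3 \<Rightarrow> 3) set" and n and f :: "_ \<Rightarrow> 'd op3"
    unfolding trace_def by (simp add: sum_distrib_left) (rule sum.swap)
  moreover have "perm_op (s3 k) ** perm_op (inv (s3 j)) = (perm_op (s3 k \<circ> inv (s3 j)) :: 'd op3)"
    if "k \<in> {1..6}" for k
    using perm_op_mult[OF bij_s3[OF that] bij_imp_bij_inv[OF bij_s3[OF assms]]] by metis
  ultimately show ?thesis
    unfolding mult_sum_cscale by (simp add: sum_S3[of "\<lambda>\<pi>. m \<pi> * trace (perm_op \<pi> ** _)"])
qed

theorem proposition3p37:
  fixes \<mu> :: "(complex^'d^'d) measure"
    and A :: "'d op3"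
    and a :: "nat \<Rightarrow> complex"
    and c :: "(3 \<Rightarrow> 3) \<Rightarrow> complex"
    and d :: nat and W1 W2 W3 :: complex
  assumes "d = CARD('d)" and "d \<ge> 3"
    and "normalized_haar_unitary \<mu>"
    and "\<forall>j\<in>{1..6}. a j = trace (A ** perm_op (inv (s3 j)))"
    and "W1 = Wg3 d (conj_class 1)" and "W2 = Wg3 d (conj_class 2)" and "W3 = Wg3 d (conj_class 3)"
    and "c (s3 1) = a 1 * W1 + (a 2 + a 3 + a 4) * W2 + (a 5 + a 6) * W3"
    and "c (s3 2) = a 2 * W1 + (a 1 + a 5 + a 6) * W2 + (a 3 + a 4) * W3"
    and "c (s3 3) = a 3 * W1 + (a 1 + a 5 + a 6) * W2 + (a 2 + a 4) * W3"
    and "c (s3 4) = a 4 * W1 + (a 1 + a 5 + a 6) * W2 + (a 2 + a 3) * W3"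
    and "c (s3 5) = a 5 * W1 + (a 2 + a 3 + a 4) * W2 + (a 1 + a 6) * W3"
    and "c (s3 6) = a 6 * W1 + (a 2 + a 3 + a 4) * W2 + (a 1 + a 5) * W3"
  shows "entrywise_integral \<mu> (\<lambda>U. tensor_cube U ** A ** conj_transpose (tensor_cube U))
           = (\<Sum>\<pi>\<in>S3. c \<pi> *\<^sub>M perm_op \<pi>)
       \<and> (\<Sum>\<pi>\<in>S3. c \<pi> *\<^sub>M perm_op \<pi>) = (\<Sum>j=1..6. c (s3 j) *\<^sub>M (perm_op (s3 j) :: 'd op3))
       \<and> S3 = {s3 1, s3 2, s3 3, s3 4, s3 5, s3 6}
       \<and> W1 = (of_nat d ^ 2 - 2)
                / ((of_nat d - 2) * (of_nat d - 1) * of_nat d * (of_nat d + 1) * (of_nat d + 2))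
       \<and> W2 = - (1 / ((of_nat d - 2) * (of_nat d - 1) * (of_nat d + 1) * (of_nat d + 2)))
       \<and> W3 = 2 / ((of_nat d - 2) * (of_nat d - 1) * of_nat d * (of_nat d + 1) * (of_nat d + 2))"
proof -
  define D where "D = (of_nat d :: complex)"
  let ?M = "entrywise_integral \<mu> (\<lambda>U. tensor_cube U ** A ** conj_transpose (tensor_cube U))"
  obtain m where m: "?M = (\<Sum>\<pi>\<in>S3. m \<pi> *\<^sub>M perm_op \<pi>)"
    by (rule commutant_tensor_cube[OF twirl_commutes[OF assms(3)]]) (use assms(1,2) in simp)
  \<comment> \<open>Averaging preserves traces against permutation operators, so \<open>a\<close> is
    the Gram matrix applied to the unknown \<open>m\<close>.\<close>
  have "a j = (\<Sum>k=1..6. m (s3 k) * trace (perm_op (s3 k \<circ> inv (s3 j)) :: 'd op3))"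
    if "j \<in> {1..6}" for j
  proof -
    have "bij (inv (s3 j))"
      by (rule bij_imp_bij_inv[OF bij_s3[OF that]])
    then have "trace (A ** perm_op (inv (s3 j))) = trace (?M ** perm_op (inv (s3 j)))"
      by (rule trace_twirl_perm_op[OF assms(3), symmetric])
    then show ?thesis
      using that assms(4) unfolding m trace_sum_perm_op[OF that] by simp
  qed
  note gram = this[unfolded atLeastAtMost_1_6]
  \<comment> \<open>The power of \<open>D\<close> at \<open>m (s3 k)\<close> in \<open>a j\<close>
    counts the cycles of \<open>s3 k \<circ> inv (s3 j)\<close>: 3 for \<open>k = j\<close>, 2 for
    opposite parity, 1 for a 3-cycle.\<close>
  have a: "a 1 = m (s3 1) * D ^ 3 + (m (s3 2) + m (s3 3) + m (s3 4)) * D\<^sup>2 + (m (s3 5) + m (s3 6)) * D"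
    "a 2 = m (s3 2) * D ^ 3 + (m (s3 1) + m (s3 5) + m (s3 6)) * D\<^sup>2 + (m (s3 3) + m (s3 4)) * D"
    "a 3 = m (s3 3) * D ^ 3 + (m (s3 1) + m (s3 5) + m (s3 6)) * D\<^sup>2 + (m (s3 2) + m (s3 4)) * D"
    "a 4 = m (s3 4) * D ^ 3 + (m (s3 1) + m (s3 5) + m (s3 6)) * D\<^sup>2 + (m (s3 2) + m (s3 3)) * D"
    "a 5 = m (s3 5) * D ^ 3 + (m (s3 2) + m (s3 3) + m (s3 4)) * D\<^sup>2 + (m (s3 1) + m (s3 6)) * D"
    "a 6 = m (s3 6) * D ^ 3 + (m (s3 2) + m (s3 3) + m (s3 4)) * D\<^sup>2 + (m (s3 1) + m (s3 5)) * D"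
    by (subst gram, simp, simp add: inv_s3 s3_comp trace_perm_op_s3 D_def assms(1) algebra_simps)+
  \<comment> \<open>The values of the convolution in \<open>Wg3_gram\<close> on the three classes.
    Substituting \<open>a\<close> into \<open>c\<close> and collecting by \<open>m\<close> gives
    exactly these coefficients, which are then 1, 0 and 0.\<close>
  let ?E1 = "W1 * D ^ 3 + 3 * W2 * D\<^sup>2 + 2 * W3 * D"
    and ?E2 = "W1 * D\<^sup>2 + W2 * D ^ 3 + 2 * W2 * D + 2 * W3 * D\<^sup>2"
    and ?E3 = "W1 * D + 3 * W2 * D\<^sup>2 + W3 * D ^ 3 + W3 * D"
  have "c (s3 1) = m (s3 1) * ?E1 + (m (s3 2) + m (s3 3) + m (s3 4)) * ?E2 + (m (s3 5) + m (s3 6)) * ?E3"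
    "c (s3 2) = m (s3 2) * ?E1 + (m (s3 1) + m (s3 5) + m (s3 6)) * ?E2 + (m (s3 3) + m (s3 4)) * ?E3"
    "c (s3 3) = m (s3 3) * ?E1 + (m (s3 1) + m (s3 5) + m (s3 6)) * ?E2 + (m (s3 2) + m (s3 4)) * ?E3"
    "c (s3 4) = m (s3 4) * ?E1 + (m (s3 1) + m (s3 5) + m (s3 6)) * ?E2 + (m (s3 2) + m (s3 3)) * ?E3"
    "c (s3 5) = m (s3 5) * ?E1 + (m (s3 2) + m (s3 3) + m (s3 4)) * ?E2 + (m (s3 1) + m (s3 6)) * ?E3"
    "c (s3 6) = m (s3 6) * ?E1 + (m (s3 2) + m (s3 3) + m (s3 4)) * ?E2 + (m (s3 1) + m (s3 5)) * ?E3"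
    unfolding assms(8-13) a by (simp_all add: power3_eq_cube power2_eq_square algebra_simps)
  then have "c (s3 1) = m (s3 1)" "c (s3 2) = m (s3 2)" "c (s3 3) = m (s3 3)"
    "c (s3 4) = m (s3 4)" "c (s3 5) = m (s3 5)" "c (s3 6) = m (s3 6)"
    unfolding Wg3_gram[OF D_def assms(2,5-7)] by simp_all
  then have "?M = (\<Sum>\<pi>\<in>S3. c \<pi> *\<^sub>M perm_op \<pi>)"
    unfolding m S3_eq by (intro sum.cong) auto
  then show ?thesis
    using sum_S3[of "\<lambda>\<pi>. c \<pi> *\<^sub>M (perm_op \<pi> :: 'd op3)"] S3_eq Wg3_conj_class assms(5-7) by simp
qed

end
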